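(* Let $G$ be a weighted network with set of cells $C=\{1,\ldots,n\}$ and let $\Delta_{\mathcal P}$ be a generalized polydiagonal subspace of $\mathbb{R}^n$ for a tagged partition $\mathcal P=\{P_1,\ldots,P_p,\overline P_1,\ldots,\overline P_q,P_0\}$ of $C$ determined by $p,q,r$. Consider an enumeration of $C$ adapted to $\mathcal P$ and the corresponding blocks of the adjacency matrix $W_G$. The Laplacian matrix $L_G$ leaves $\Delta_{\mathcal P}$ invariant if and only if the blocks of $W_G$ satisfy the following conditions (terms involving $Z_{i0},\overline Z_{i0}$ are omitted, and (v), (vi) are void, when $r=0$). When $q>0$: (i) For each $i\in\{1,\ldots,q\}$ the column vectors $$\sum_{j=1,\,j\ne i}^{p}\mathrm{rs}(Q_{ij})+\sum_{j=1,\,j\ne i}^{q}\mathrm{rs}(R_{ij})+2\,\mathrm{rs}(R_{ii})+\mathrm{rs}(Z_{i0})\quad\text{and}\quad \sum_{j=1,\,j\ne i}^{q}\mathrm{rs}(\overline Q_{ij})+\sum_{j=1,\,j\ne i}^{p}\mathrm{rs}(\overline R_{ij})+2\,\mathrm{rs}(\overline R_{ii})+\mathrm{rs}(\overline Z_{i0})$$ are regular of the same valency $r_i$; and for each $i,j\in\{1,\ldots,q\}$ with $j\neq i$ the column vectors $-\mathrm{rs}(Q_{ij})+\mathrm{rs}(R_{ij})$ and $\mathrm{rs}(\overline R_{ij})-\mathrm{rs}(\overline Q_{ij})$ are regular of the same valency $q_{ij}$. (ii) For each $i\in\{1,\ldots,q\}$ and $j\in\{q+1,\ldots,p\}$, $-\mathrm{rs}(Q_{ij})$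 and $\mathrm{rs}(\overline R_{ij})$ are regular of the same valency $q_{ij}$. For all $q\ge 0$: (iii) For each $i\in\{q+1,\ldots,p\}$, $$\sum_{j=1,\,j\ne i}^{p}\mathrm{rs}(Q_{ij})+\sum_{j=1}^{q}\mathrm{rs}(R_{ij})+\mathrm{rs}(Z_{i0})$$ is regular of some valency $r_i$; and for each $i\in\{q+1,\ldots,p\}$ and $j\in\{1,\ldots,q\}$, $-\mathrm{rs}(Q_{ij})+\mathrm{rs}(R_{ij})$ is regular of some valency $q_{ij}$. (iv) For each $i,j\in\{q+1,\ldots,p\}$ with $j\ne i$, $-Q_{ij}$ is regular of some valency $q_{ij}$. (v) If $q>0$, for each $j\in\{1,\ldots,q\}$, $\mathrm{rs}(Z_{0j})=\mathrm{rs}(\overline Z_{0j})$. (vi) For all $q\ge 0$ and each $j\in\{q+1,\ldots,p\}$, $Z_{0j}$ is regular of valency zero.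
   Context: A weighted network $G$ with set of cells $C=\{1,\ldots,n\}$ is a directed graph with real edge weights. Its adjacency matrix is $W_G=[w_{ij}]\in\mathbb{R}^{n\times n}$, where $w_{ij}$ is the weight of the edge from cell $j$ to cell $i$ (zero if there is no such edge; self-loops allowed). The input valency of cell $i$ is $v(i)=\sum_{j\in C}w_{ij}$. The Laplacian matrix is $L_G=D_G-W_G$, where $D_G$ is the diagonal matrix with diagonal entries $v(1),\ldots,v(n)$. Tagged partition: let $p,q,r$ be nonnegative integers with $0\le q\le p\le n$, $r\in\{0,1\}$. A tagged partition $\mathcal P$ of $C$ determined by $p,q,r$ is a partition of $C$ into $p+q+r$ disjoint nonempty parts: $P_1,\ldots,P_p$; $\overline P_1,\ldots,\overline P_q$, where $\overline P_l$ is called the counterpart of $P_l$ (and $P_l$ the counterpart of $\overline P_l$); and, if $r=1$, a part $P_0$ called the zero part. The generalized polydiagonal subspace associated with $\mathcal P$ is $\Delta_{\mathcal P}=\{x\in\mathbb{R}^n: x_j=x_i$ if $j$ is in the same part as $i$; $x_j=-x_i$ if $j$ is in the counterpart of the part of $i$; $x_j=0$ if $j\in P_0\}$. A matrix $M$ leaves $\Delta$ invariant if $M\Delta\subseteq\Delta$. Blocks of $W_G$: for $A,B\subseteq C$ write $W[A,B]$ for the submatrix of $W_G$ with rows in $A$ and columns in $B$ (connections to $A$ from $B$). An enumeration of $C$ is adapted to $\mathcal P$ if cells of the same part are consecutive, with the parts ordered $P_1,\ldots,P_p,\overline P_1,\ldots,\overline P_q,P_0$. The blocks are $Q_{ij}=W[P_i,P_j]$,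 $R_{ij}=W[P_i,\overline P_j]$, $Z_{i0}=W[P_i,P_0]$, $\overline R_{ij}=W[\overline P_i,P_j]$, $\overline Q_{ij}=W[\overline P_i,\overline P_j]$, $\overline Z_{i0}=W[\overline P_i,P_0]$, $Z_{0j}=W[P_0,P_j]$, $\overline Z_{0j}=W[P_0,\overline P_j]$, $Z_{00}=W[P_0,P_0]$. $\mathrm{rs}$ is the row sum operator: $\mathrm{rs}(B)$ is the column vector whose $i$-th entry is the sum of the entries of the $i$-th row of $B$. A (possibly rectangular) matrix or column vector is regular of valency $v$ if all its row sums equal $v$ (for a column vector: all entries equal $v$). Two column vectors that are regular of the same valency need not have the same length. *)

theory Defs
  imports Complex_Main "Jordan_Normal_Form.DL_Submatrix"
begin

text \<open>
  Matrices and vectors are those of \<open>Jordan_Normal_Form\<close>, whose indices start at 0.  The cells of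
  a network with \<open>n\<close> cells are therefore \<open>0, \<dots>, n - 1\<close> instead of \<open>1, \<dots>, n\<close>.
  The edge \<open>(j, i)\<close> goes from cell \<open>j\<close> to cell \<open>i\<close>.
\<close>

record weighted_network =
  num_cells :: nat
  edges :: "(nat \<times> nat) set"
  weight :: "nat \<times> nat \<Rightarrow> real"

definition cells :: "weighted_network \<Rightarrow> nat set" where
  "cells G = {0..<num_cells G}"

definition weighted_network :: "weighted_network \<Rightarrow> bool" where
  "weighted_network G \<longleftrightarrow> edges G \<subseteq> cells G \<times> cells G"

definition adjacency :: "weighted_network \<Rightarrow> real mat" where
  "adjacency G = mat (num_cells G) (num_cells G)
     (\<lambda>(i, j). if (j, i) \<in> edges G then weight G (j, i) else 0)"

definition valency :: "weighted_network \<Rightarrow> nat \<Rightarrow> real" where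
  "valency G i = (\<Sum>j\<in>cells G. adjacency G $$ (i, j))"

definition laplacian :: "weighted_network \<Rightarrow> real mat" where
  "laplacian G = mat_diag (num_cells G) (valency G) - adjacency G"

definition leaves_invariant :: "real mat \<Rightarrow> real vec set \<Rightarrow> bool" where
  "leaves_invariant M \<Delta> \<longleftrightarrow> (\<lambda>x. M *\<^sub>v x) ` \<Delta> \<subseteq> \<Delta>"

text \<open>
  The parts of a tagged partition are indexed by labels: \<open>Part i\<close> stands for \<open>P\<^sub>i\<close>,
  \<open>Counter i\<close> for its counterpart, and \<open>Zero_part\<close> for \<open>P\<^sub>0\<close>.
\<close>

datatype part_label = Part nat | Counter nat | Zero_part

definition labels :: "nat \<Rightarrow> nat \<Rightarrow> nat \<Rightarrow> part_label list" where
  "labels p q r = map Part [1..<p + 1] @ map Counter [1..<q + 1] @ (if r = 1 then [Zero_part] else [])"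

definition tagged_partition ::
  "nat \<Rightarrow> nat \<Rightarrow> nat \<Rightarrow> nat \<Rightarrow> (part_label \<Rightarrow> nat set) \<Rightarrow> bool" where
  "tagged_partition n p q r P \<longleftrightarrow>
     q \<le> p \<and> p \<le> n \<and> r \<in> {0, 1} \<and>
     (\<forall>t\<in>set (labels p q r). P t \<noteq> {}) \<and>
     (\<forall>s\<in>set (labels p q r). \<forall>t\<in>set (labels p q r). s \<noteq> t \<longrightarrow> P s \<inter> P t = {}) \<and>
     (\<Union>t\<in>set (labels p q r). P t) = {0..<n}"

definition polydiagonal ::
  "nat \<Rightarrow> nat \<Rightarrow> nat \<Rightarrow> nat \<Rightarrow> (part_label \<Rightarrow> nat set) \<Rightarrow> real vec set" where
  "polydiagonal n p q r P = {x \<in> carrier_vec n.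
     (\<forall>t\<in>set (labels p q r). \<forall>i\<in>P t. \<forall>j\<in>P t. x $ j = x $ i) \<and>
     (\<forall>l\<in>{1..q}. \<forall>i\<in>P (Part l). \<forall>j\<in>P (Counter l). x $ j = - x $ i) \<and>
     (r = 1 \<longrightarrow> (\<forall>j\<in>P Zero_part. x $ j = 0))}"

text \<open>
  An enumeration is given by the bijection \<open>\<sigma>\<close> sending a position to the cell placed there.
  Requiring that all positions of an earlier part precede all positions of a later one also makes the
  cells of each part consecutive.
\<close>

definition adapted_enumeration ::
  "nat \<Rightarrow> nat \<Rightarrow> nat \<Rightarrow> nat \<Rightarrow> (part_label \<Rightarrow> nat set) \<Rightarrow> (nat \<Rightarrow> nat) \<Rightarrow> bool" where
  "adapted_enumeration n p q r P \<sigma> \<longleftrightarrow>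
     bij_betw \<sigma> {0..<n} {0..<n} \<and>
     sorted_wrt (\<lambda>s t. \<forall>a<n. \<forall>b<n. \<sigma> a \<in> P s \<longrightarrow> \<sigma> b \<in> P t \<longrightarrow> a < b) (labels p q r)"

definition reindexed_adjacency :: "weighted_network \<Rightarrow> (nat \<Rightarrow> nat) \<Rightarrow> real mat" where
  "reindexed_adjacency G \<sigma> =
     mat (num_cells G) (num_cells G) (\<lambda>(a, b). adjacency G $$ (\<sigma> a, \<sigma> b))"

definition block :: "weighted_network \<Rightarrow> (nat \<Rightarrow> nat) \<Rightarrow> nat set \<Rightarrow> nat set \<Rightarrow> real mat" where
  "block G \<sigma> A B = submatrix (reindexed_adjacency G \<sigma>) {a. \<sigma> a \<in> A} {b. \<sigma> b \<in> B}"

definition rs :: "real mat \<Rightarrow> real vec" where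
  "rs B = vec (dim_row B) (\<lambda>i. \<Sum>j<dim_col B. B $$ (i, j))"

definition regular_mat :: "real mat \<Rightarrow> real \<Rightarrow> bool" where
  "regular_mat B v \<longleftrightarrow> (\<forall>i<dim_row B. rs B $ i = v)"

definition regular_vec :: "real vec \<Rightarrow> real \<Rightarrow> bool" where
  "regular_vec u v \<longleftrightarrow> (\<forall>i<dim_vec u. u $ i = v)"

text \<open>
  The type of vectors does not fix their length, so the empty sum has to be told the length \<open>m\<close>.
\<close>

abbreviation vsum :: "nat \<Rightarrow> nat set \<Rightarrow> (nat \<Rightarrow> real vec) \<Rightarrow> real vec" where
  "vsum m S f \<equiv> finsum_vec TYPE(real) m f S"

end

theory Submission
  imports Defs
begin

text \<open>
  A vector of the polydiagonal subspace is given by its values \<open>y\<^sub>1, \<dots>, y\<^sub>p\<close> on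
  \<open>P\<^sub>1, \<dots>, P\<^sub>p\<close>, and its image under the Laplacian is linear in \<open>y\<close>.  So the image stays in the
  subspace for every \<open>y\<close> iff each coefficient of \<open>y\<^sub>k\<close>, as a function of the cell, is constant
  on every \<open>P\<^sub>i\<close>, takes the opposite value on the counterpart and vanishes on \<open>P\<^sub>0\<close>.
  Once the valency is expanded as the sum of the inputs from all parts, these coefficients
  (negated on counterparts) are the entries of the vectors in (i)--(vi).
\<close>

section \<open>Row sums of blocks as functions of the cells\<close>

lemma bij_betw_pick:
  "bij_betw (pick I) {..<card {i. i < n \<and> i \<in> I}} {i. i < n \<and> i \<in> I}" (is "bij_betw _ ?K ?J")
proof -
  \<comment> \<open>The sets \<open>{a. \<sigma> a \<in> A}\<close> that select rows and columns may
    contain positions beyond the dimension, where \<sigma> is arbitrary, and may even be infinite.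
    So only the elements below \<open>n\<close> are counted, and their number is compared with
    \<open>card I\<close> when \<open>I\<close> is finite.\<close>
  have le: "card ?J \<le> card I" if "finite I"
    using that by (intro card_mono) auto
  have bound: "a < card I \<or> infinite I" if "a \<in> ?K" for a
    using that le by fastforce
  have "pick I a \<noteq> pick I b" if "a < b" "b \<in> ?K" for a b
    using pick_mono[OF bound[OF that(2)] that(1)] by simp
  then have inj: "inj_on (pick I) ?K"
    by (intro linorder_inj_onI') blast
  have "pick I ` ?K \<subseteq> ?J"
    using bound pick_in_set pick_le by fastforce
  then have "pick I ` ?K = ?J"
    by (intro card_subset_eq) (auto simp: card_image[OF inj])
  with inj show ?thesis
    by (simp add: bij_betw_def)
qed

text \<open>The cell to which row or column \<open>a\<close> of a block belongs.\<close>

definition nth_cell :: "(nat \<Rightarrow> nat) \<Rightarrow> nat set \<Rightarrow> nat \<Rightarrow> nat" where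
  "nth_cell \<sigma> A a = \<sigma> (pick {a. \<sigma> a \<in> A} a)"

text \<open>Common form of all vectors in the conditions. Since \<open>nth_cell\<close> runs through
  all of \<open>A\<close>, regularity and equality of such vectors become statements about the cells
  of \<open>A\<close>, free of the enumeration.\<close>

definition part_vec :: "(nat \<Rightarrow> nat) \<Rightarrow> nat set \<Rightarrow> (nat \<Rightarrow> real) \<Rightarrow> real vec" where
  "part_vec \<sigma> A f = vec (card A) (\<lambda>a. f (nth_cell \<sigma> A a))"

definition input_from :: "weighted_network \<Rightarrow> nat set \<Rightarrow> nat \<Rightarrow> real" where
  "input_from G B c = (\<Sum>d\<in>B. adjacency G $$ (c, d))"

lemma part_vec_carrier [simp]: "part_vec \<sigma> A f \<in> carrier_vec (card A)"
  and dim_part_vec [simp]: "dim_vec (part_vec \<sigma> A f) = card A"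
  by (simp_all add: part_vec_def)

lemma part_vec_add: "part_vec \<sigma> A f + part_vec \<sigma> A g = part_vec \<sigma> A (\<lambda>c. f c + g c)"
  and part_vec_diff: "part_vec \<sigma> A f - part_vec \<sigma> A g = part_vec \<sigma> A (\<lambda>c. f c - g c)"
  and part_vec_uminus: "- part_vec \<sigma> A f = part_vec \<sigma> A (\<lambda>c. - f c)"
  and part_vec_smult: "k \<cdot>\<^sub>v part_vec \<sigma> A f = part_vec \<sigma> A (\<lambda>c. k * f c)"
  and part_vec_zero: "0\<^sub>v (card A) = part_vec \<sigma> A (\<lambda>c. 0)"
  by (auto simp: part_vec_def)

lemma part_vec_sum:
  assumes "finite J"
  shows "vsum (card A) J (\<lambda>j. part_vec \<sigma> A (f j)) = part_vec \<sigma> A (\<lambda>c. \<Sum>j\<in>J. f j c)"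
proof (rule eq_vecI)
  show "vsum (card A) J (\<lambda>j. part_vec \<sigma> A (f j)) $ a = part_vec \<sigma> A (\<lambda>c. \<Sum>j\<in>J. f j c) $ a"
    if "a < dim_vec (part_vec \<sigma> A (\<lambda>c. \<Sum>j\<in>J. f j c))" for a
    using that assms by (subst index_finsum_vec) (auto simp: part_vec_def)
  have "vsum (card A) J (\<lambda>j. part_vec \<sigma> A (f j)) \<in> carrier_vec (card A)"
    by (intro finsum_vec_closed) auto
  then show "dim_vec (vsum (card A) J (\<lambda>j. part_vec \<sigma> A (f j)))
      = dim_vec (part_vec \<sigma> A (\<lambda>c. \<Sum>j\<in>J. f j c))"
    by simp
qed

lemma rs_uminus: "rs (- M) = - rs M"
  by (rule eq_vecI) (auto simp: rs_def sum_negf)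

lemma regular_mat_iff: "regular_mat M v \<longleftrightarrow> regular_vec (rs M) v"
  by (simp add: regular_mat_def regular_vec_def rs_def)

locale enumerated_cells =
  fixes G :: weighted_network and \<sigma> :: "nat \<Rightarrow> nat"
  assumes enum: "bij_betw \<sigma> {0..<num_cells G} {0..<num_cells G}"
begin

abbreviation "N \<equiv> num_cells G"

lemma positions_bij:
  assumes "A \<subseteq> {0..<N}"
  shows "bij_betw \<sigma> {a. a < N \<and> a \<in> {a. \<sigma> a \<in> A}} A"
proof (rule bij_betw_subset[OF enum])
  show "\<sigma> ` {a. a < N \<and> a \<in> {a. \<sigma> a \<in> A}} = A"
  proof
    show "A \<subseteq> \<sigma> ` {a. a < N \<and> a \<in> {a. \<sigma> a \<in> A}}"
    proof
      fix c assume c: "c \<in> A"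
      then have "c \<in> \<sigma> ` {0..<N}"
        using assms bij_betw_imp_surj_on[OF enum] by auto
      then show "c \<in> \<sigma> ` {a. a < N \<and> a \<in> {a. \<sigma> a \<in> A}}"
        using c by auto
    qed
  qed auto
qed auto

lemma card_positions:
  assumes "A \<subseteq> {0..<N}"
  shows "card {a. a < N \<and> a \<in> {a. \<sigma> a \<in> A}} = card A"
  using bij_betw_same_card[OF positions_bij[OF assms]] .

lemma nth_cell_bij:
  assumes "A \<subseteq> {0..<N}"
  shows "bij_betw (nth_cell \<sigma> A) {..<card A} A"
  using bij_betw_trans[OF bij_betw_pick[of "{a. \<sigma> a \<in> A}" N] positions_bij[OF assms]]
  unfolding card_positions[OF assms] by (simp add: nth_cell_def[abs_def] comp_def)

lemma regular_part_vec:
  assumes "A \<subseteq> {0..<N}"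
  shows "regular_vec (part_vec \<sigma> A f) v \<longleftrightarrow> (\<forall>c\<in>A. f c = v)"
proof -
  have "regular_vec (part_vec \<sigma> A f) v \<longleftrightarrow> (\<forall>c\<in>nth_cell \<sigma> A ` {..<card A}. f c = v)"
    by (auto simp: regular_vec_def part_vec_def)
  then show ?thesis
    using bij_betw_imp_surj_on[OF nth_cell_bij[OF assms]] by simp
qed

lemma part_vec_eq_iff:
  assumes "A \<subseteq> {0..<N}"
  shows "part_vec \<sigma> A f = part_vec \<sigma> A g \<longleftrightarrow> (\<forall>c\<in>A. f c = g c)"
proof -
  have "part_vec \<sigma> A f = part_vec \<sigma> A g \<longleftrightarrow> (\<forall>c\<in>nth_cell \<sigma> A ` {..<card A}. f c = g c)"
    by (auto simp: vec_eq_iff part_vec_def)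
  then show ?thesis
    using bij_betw_imp_surj_on[OF nth_cell_bij[OF assms]] by simp
qed

lemma block_dims:
  assumes "A \<subseteq> {0..<N}" "B \<subseteq> {0..<N}"
  shows "dim_row (block G \<sigma> A B) = card A" "dim_col (block G \<sigma> A B) = card B"
  using card_positions[OF assms(1)] card_positions[OF assms(2)]
  by (simp_all add: block_def dim_submatrix reindexed_adjacency_def)

lemma block_entry:
  assumes "A \<subseteq> {0..<N}" "B \<subseteq> {0..<N}" "a < card A" "b < card B"
  shows "block G \<sigma> A B $$ (a, b) = adjacency G $$ (nth_cell \<sigma> A a, nth_cell \<sigma> B b)"
proof -
  have "pick {a. \<sigma> a \<in> A} a < N" "pick {a. \<sigma> a \<in> B} b < N"
    using assms card_positions[OF assms(1)] card_positions[OF assms(2)] by (auto intro!: pick_le)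
  then show ?thesis
    using assms card_positions[OF assms(1)] card_positions[OF assms(2)]
    by (simp add: block_def submatrix_index reindexed_adjacency_def nth_cell_def)
qed

lemma rs_block:
  assumes "A \<subseteq> {0..<N}" "B \<subseteq> {0..<N}"
  shows "rs (block G \<sigma> A B) = part_vec \<sigma> A (input_from G B)"
proof (rule eq_vecI)
  fix a assume "a < dim_vec (part_vec \<sigma> A (input_from G B))"
  then have a: "a < card A" by simp
  have "rs (block G \<sigma> A B) $ a
      = (\<Sum>b<card B. adjacency G $$ (nth_cell \<sigma> A a, nth_cell \<sigma> B b))"
    using a assms by (simp add: rs_def block_dims block_entry)
  \<comment> \<open>A row sum does not depend on the order of the columns.\<close>
  also have "\<dots> = input_from G B (nth_cell \<sigma> A a)"
    unfolding input_from_def by (rule sum.reindex_bij_betw[OF nth_cell_bij[OF assms(2)]])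
  finally show "rs (block G \<sigma> A B) $ a = part_vec \<sigma> A (input_from G B) $ a"
    using a by (simp add: part_vec_def)
qed (use assms in \<open>simp add: rs_def block_dims\<close>)

end

section \<open>Labels, sums over labels and regrouping of conditions\<close>

fun signed_value :: "(nat \<Rightarrow> real) \<Rightarrow> part_label \<Rightarrow> real" where
  "signed_value y (Part i) = y i"
| "signed_value y (Counter i) = - y i"
| "signed_value y Zero_part = 0"

lemma set_labels:
  "set (labels p q r) = Part ` {1..p} \<union> Counter ` {1..q} \<union> (if r = 1 then {Zero_part} else {})"
  by (auto simp: labels_def)

lemma sum_labels:
  "(\<Sum>t\<in>set (labels p q r). f t)
    = (\<Sum>i=1..p. f (Part i)) + (\<Sum>i=1..q. f (Counter i)) + (if r = 1 then f Zero_part else 0)"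
proof -
  have "(\<Sum>t\<in>Part ` {1..p} \<union> Counter ` {1..q}. f t)
      = (\<Sum>i=1..p. f (Part i)) + (\<Sum>i=1..q. f (Counter i))"
    by (subst sum.union_disjoint) (auto simp: sum.reindex inj_on_def)
  moreover have "Zero_part \<notin> Part ` {1..p} \<union> Counter ` {1..q}"
    by auto
  ultimately show ?thesis
    by (simp add: set_labels add.commute)
qed

text \<open>Pure logic for the final step, with \<open>A\<close> the paired indices
  \<open>{1..q}\<close>, \<open>B\<close> the unpaired ones \<open>{q+1..p}\<close>,
  \<open>g\<close> for \<open>q > 0\<close> and \<open>z\<close> for \<open>r = 1\<close>. Index
  pairs are sorted by range and the diagonal is split off. The guard \<open>g\<close> changes
  nothing, because by the assumption \<open>A\<close> is empty when \<open>g\<close> fails.\<close>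

lemma regroup_conditions:
  assumes "\<And>i. i \<in> A \<Longrightarrow> g"
  shows "((\<forall>i\<in>A. (\<forall>k\<in>A. D i k) \<and> (\<forall>k\<in>B. D i k)) \<and> (\<forall>i\<in>B. (\<forall>k\<in>A. D i k) \<and> (\<forall>k\<in>B. D i k))) \<and>
      (z \<longrightarrow> (\<forall>k\<in>A. E k) \<and> (\<forall>k\<in>B. E k)) \<longleftrightarrow>
    (g \<longrightarrow> (\<forall>i\<in>A. D i i) \<and> (\<forall>i\<in>A. \<forall>j\<in>A. j \<noteq> i \<longrightarrow> D i j) \<and> (\<forall>i\<in>A. \<forall>j\<in>B. D i j)) \<and>
    (\<forall>i\<in>B. D i i) \<and> (\<forall>i\<in>B. \<forall>j\<in>A. D i j) \<and> (\<forall>i\<in>B. \<forall>j\<in>B. j \<noteq> i \<longrightarrow> D i j) \<and>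
    (z \<longrightarrow> g \<longrightarrow> (\<forall>j\<in>A. E j)) \<and> (z \<longrightarrow> (\<forall>j\<in>B. E j))"
proof -
  have pairs: "(\<forall>i\<in>S. \<forall>k\<in>S. D i k) \<longleftrightarrow>
      (\<forall>i\<in>S. D i i) \<and> (\<forall>i\<in>S. \<forall>k\<in>S. k \<noteq> i \<longrightarrow> D i k)" for S
    by metis
  have guard: "(g \<longrightarrow> (\<forall>i\<in>A. F i)) \<longleftrightarrow> (\<forall>i\<in>A. F i)" for F
    using assms by metis
  show ?thesis
    unfolding ball_conj_distrib imp_conjR guard pairs by argo
qed

section \<open>The Laplacian on the polydiagonal subspace\<close>

locale tagged_network = enumerated_cells +
  fixes p q r :: nat and P :: "part_label \<Rightarrow> nat set"
  assumes tagged: "tagged_partition (num_cells G) p q r P"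
begin

abbreviation "\<L> \<equiv> set (labels p q r)"
abbreviation "\<Delta> \<equiv> polydiagonal N p q r P"

lemma q_le_p: "q \<le> p"
  and part_nonempty: "t \<in> \<L> \<Longrightarrow> P t \<noteq> {}"
  and part_disjoint: "s \<in> \<L> \<Longrightarrow> t \<in> \<L> \<Longrightarrow> s \<noteq> t \<Longrightarrow> P s \<inter> P t = {}"
  and parts_cover: "(\<Union>t\<in>\<L>. P t) = {0..<N}"
  using tagged by (auto simp: tagged_partition_def)

lemma part_subset: "t \<in> \<L> \<Longrightarrow> P t \<subseteq> {0..<N}"
  using parts_cover by blast

lemma part_finite: "t \<in> \<L> \<Longrightarrow> finite (P t)"
  using part_subset finite_subset by blast

lemma sum_parts: "(\<Sum>d\<in>{0..<N}. f d) = (\<Sum>t\<in>\<L>. \<Sum>d\<in>P t. f d)"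
  unfolding parts_cover[symmetric]
  using part_finite part_disjoint by (intro sum.UNION_disjoint) auto

lemma polydiagonal_iff:
  "x \<in> \<Delta> \<longleftrightarrow> x \<in> carrier_vec N \<and> (\<exists>y. \<forall>t\<in>\<L>. \<forall>c\<in>P t. x $ c = signed_value y t)"
proof
  assume x: "x \<in> \<Delta>"
  \<comment> \<open>Any cell of the part would do, as \<open>x\<close> is constant there.\<close>
  define y where "y i = x $ (SOME c. c \<in> P (Part i))" for i
  have const: "x $ c = x $ d" if "t \<in> \<L>" "c \<in> P t" "d \<in> P t" for t c d
    using x that unfolding polydiagonal_def by blast
  have y: "x $ c = y i" if "i \<in> {1..p}" "c \<in> P (Part i)" for i c
    unfolding y_def by (rule const[of "Part i"]) (use that in \<open>auto simp: set_labels intro: someI\<close>)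
  have "x $ c = signed_value y t" if t: "t \<in> \<L>" and c: "c \<in> P t" for t c
  proof (cases t)
    case (Part i)
    then show ?thesis using y t c by (auto simp: set_labels split: if_splits)
  next
    case (Counter i)
    then have i: "i \<in> {1..q}" using t by (auto simp: set_labels split: if_splits)
    \<comment> \<open>The coordinate is read off on \<open>P (Part i)\<close>, so a cell of that
      part is needed to transfer the value to the counterpart; it exists because parts are
      nonempty.\<close>
    then have "Part i \<in> \<L>" using q_le_p by (auto simp: set_labels)
    then obtain d where "d \<in> P (Part i)" using part_nonempty by blast
    moreover have "x $ c = - x $ d"
      using x i c Counter calculation unfolding polydiagonal_def by blast
    ultimately show ?thesis using y[of i d] i q_le_p Counter by simp
  next
    case Zero_part
    then have "r = 1" using t by (auto simp: set_labels split: if_splits)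
    then show ?thesis using x c Zero_part unfolding polydiagonal_def by auto
  qed
  then show "x \<in> carrier_vec N \<and> (\<exists>y. \<forall>t\<in>\<L>. \<forall>c\<in>P t. x $ c = signed_value y t)"
    using x by (auto simp: polydiagonal_def)
next
  assume "x \<in> carrier_vec N \<and> (\<exists>y. \<forall>t\<in>\<L>. \<forall>c\<in>P t. x $ c = signed_value y t)"
  then obtain y where x: "x \<in> carrier_vec N"
    and y: "\<And>t c. t \<in> \<L> \<Longrightarrow> c \<in> P t \<Longrightarrow> x $ c = signed_value y t" by blast
  have "x $ c = y i" if "i \<in> {1..q}" "c \<in> P (Part i)" for i c
    using y[of "Part i" c] that q_le_p by (auto simp: set_labels)
  moreover have "x $ c = - y i" if "i \<in> {1..q}" "c \<in> P (Counter i)" for i c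
    using y[of "Counter i" c] that by (auto simp: set_labels)
  moreover have "x $ c = 0" if "r = 1" "c \<in> P Zero_part" for c
    using y[of Zero_part c] that by (auto simp: set_labels)
  ultimately show "x \<in> \<Delta>"
    using x y unfolding polydiagonal_def by simp
qed

text \<open>Shows that every choice of coordinates occurs in the subspace, so that unit vectors can
  be used to isolate single coefficients.\<close>

definition lift :: "(nat \<Rightarrow> real) \<Rightarrow> real vec" where
  "lift y = vec N (\<lambda>c. signed_value y (THE t. t \<in> \<L> \<and> c \<in> P t))"

lemma lift_index:
  assumes "t \<in> \<L>" "c \<in> P t"
  shows "lift y $ c = signed_value y t"
proof -
  have "(THE t. t \<in> \<L> \<and> c \<in> P t) = t"
    using assms part_disjoint by (intro the_equality) auto
  moreover have "c < N" using part_subset[OF assms(1)] assms(2) by auto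
  ultimately show ?thesis by (simp add: lift_def)
qed

lemma lift_in_polydiagonal: "lift y \<in> \<Delta>"
  unfolding polydiagonal_iff using lift_index by (auto simp: lift_def)

text \<open>The coefficient of \<open>y k\<close> in the entry of
  \<open>adjacency G *\<^sub>v x\<close> at \<open>c\<close>. For \<open>k > q\<close> there is no
  counterpart and the set \<open>P (Counter k)\<close> is arbitrary, hence the
  \<open>if\<close>.\<close>

definition input_diff :: "nat \<Rightarrow> nat \<Rightarrow> real" where
  "input_diff k c = input_from G (P (Part k)) c - (if k \<le> q then input_from G (P (Counter k)) c else 0)"

text \<open>
  The coefficient of \<open>y\<^sub>k\<close> in the entry of \<open>L\<^sub>G x\<close> at a cell \<open>c\<close> of the part \<open>t\<close>, when
  \<open>x\<close> takes the value \<open>y\<^sub>i\<close> on \<open>P\<^sub>i\<close>, \<open>-y\<^sub>i\<close> on its counterpart and \<open>0\<close> on \<open>P\<^sub>0\<close>.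
\<close>

definition coeff :: "part_label \<Rightarrow> nat \<Rightarrow> nat \<Rightarrow> real" where
  "coeff t k c = valency G c * signed_value (\<lambda>i. if i = k then 1 else 0) t - input_diff k c"

lemma adjacency_sum:
  assumes x: "\<And>t c. t \<in> \<L> \<Longrightarrow> c \<in> P t \<Longrightarrow> x $ c = signed_value y t"
  shows "(\<Sum>d\<in>{0..<N}. adjacency G $$ (c, d) * x $ d) = (\<Sum>k=1..p. y k * input_diff k c)"
proof -
  have "(\<Sum>d\<in>{0..<N}. adjacency G $$ (c, d) * x $ d)
      = (\<Sum>t\<in>\<L>. input_from G (P t) c * signed_value y t)"
    unfolding sum_parts input_from_def sum_distrib_right using x by (intro sum.cong) auto
  also have "\<dots> = (\<Sum>k=1..p. y k * input_from G (P (Part k)) c)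
      - (\<Sum>k=1..q. y k * input_from G (P (Counter k)) c)"
    by (simp add: sum_labels sum_negf mult.commute)
  \<comment> \<open>Padding with zeros up to \<open>p\<close> lets the two sums merge into one over
    \<open>k\<close>.\<close>
  also have "(\<Sum>k=1..q. y k * input_from G (P (Counter k)) c)
      = (\<Sum>k=1..p. y k * (if k \<le> q then input_from G (P (Counter k)) c else 0))"
    using q_le_p by (intro sum.mono_neutral_cong_left) auto
  finally show ?thesis
    by (simp add: input_diff_def sum_subtractf right_diff_distrib)
qed

lemma laplacian_index:
  assumes x: "x \<in> carrier_vec N" "\<And>t c. t \<in> \<L> \<Longrightarrow> c \<in> P t \<Longrightarrow> x $ c = signed_value y t"
    and t: "t \<in> \<L>" "c \<in> P t"
  shows "(laplacian G *\<^sub>v x) $ c = (\<Sum>k=1..p. y k * coeff t k c)"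
proof -
  have c: "c < N" using part_subset[OF t(1)] t(2) by auto
  have "(laplacian G *\<^sub>v x) $ c
      = (\<Sum>d\<in>{0..<N}. (if c = d then valency G d * x $ d else 0) - adjacency G $$ (c, d) * x $ d)"
    using c x(1)
    by (auto simp: laplacian_def mat_diag_def adjacency_def scalar_prod_def left_diff_distrib
        intro!: sum.cong)
  also have "\<dots> = valency G c * signed_value y t - (\<Sum>k=1..p. y k * input_diff k c)"
    using c x(2)[OF t] adjacency_sum[OF x(2)] by (simp add: sum_subtractf)
  \<comment> \<open>The value on a part is itself expanded in unit vectors, so that the valency term
    joins the sum over \<open>k\<close>.\<close>
  also have "signed_value y t = (\<Sum>k=1..p. y k * signed_value (\<lambda>i. if i = k then 1 else 0) t)"
  proof (cases t)
    case (Part i)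
    then have "i \<in> {1..p}" using t(1) by (auto simp: set_labels split: if_splits)
    then show ?thesis using Part by (simp add: if_distrib[of "\<lambda>u. _ * u"] cong: if_cong)
  next
    case (Counter i)
    then have "i \<in> {1..p}" using t(1) q_le_p by (auto simp: set_labels split: if_splits)
    then show ?thesis
      using Counter by (simp add: if_distrib[of "\<lambda>u. _ * u"] sum_negf cong: if_cong)
  qed simp
  finally show ?thesis
    by (simp add: coeff_def sum_subtractf right_diff_distrib sum_distrib_left mult.left_commute)
qed

lemma invariant_iff:
  "leaves_invariant (laplacian G) \<Delta> \<longleftrightarrow>
    (\<forall>k\<in>{1..p}. \<exists>z. \<forall>t\<in>\<L>. \<forall>c\<in>P t. coeff t k c = signed_value z t)"
proof
  assume inv: "leaves_invariant (laplacian G) \<Delta>"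
  show "\<forall>k\<in>{1..p}. \<exists>z. \<forall>t\<in>\<L>. \<forall>c\<in>P t. coeff t k c = signed_value z t"
  proof
    fix k assume k: "k \<in> {1..p}"
    \<comment> \<open>For the \<open>k\<close>-th unit vector, the sum in
      \<open>laplacian_index\<close> collapses to the coefficient of index \<open>k\<close>.\<close>
    define y :: "nat \<Rightarrow> real" where "y i = (if i = k then 1 else 0)" for i
    have "laplacian G *\<^sub>v lift y \<in> \<Delta>"
      using inv lift_in_polydiagonal by (auto simp: leaves_invariant_def)
    then obtain z where z: "\<And>t c. t \<in> \<L> \<Longrightarrow> c \<in> P t \<Longrightarrow> (laplacian G *\<^sub>v lift y) $ c = signed_value z t"
      by (auto simp: polydiagonal_iff)
    have "coeff t k c = signed_value z t" if "t \<in> \<L>" "c \<in> P t" for t c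
    proof -
      have "(laplacian G *\<^sub>v lift y) $ c = (\<Sum>i=1..p. y i * coeff t i c)"
        using that lift_index by (intro laplacian_index) (auto simp: lift_def)
      also have "\<dots> = coeff t k c"
        using k by (simp add: y_def if_distrib[of "\<lambda>u. u * _"] cong: if_cong)
      finally show ?thesis using z that by simp
    qed
    then show "\<exists>z. \<forall>t\<in>\<L>. \<forall>c\<in>P t. coeff t k c = signed_value z t" by blast
  qed
next
  assume "\<forall>k\<in>{1..p}. \<exists>z. \<forall>t\<in>\<L>. \<forall>c\<in>P t. coeff t k c = signed_value z t"
  then obtain z where z: "\<And>k t c. k \<in> {1..p} \<Longrightarrow> t \<in> \<L> \<Longrightarrow> c \<in> P t \<Longrightarrow> coeff t k c = signed_value (z k) t"
    by metis
  show "leaves_invariant (laplacian G) \<Delta>"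
    unfolding leaves_invariant_def
  proof (rule image_subsetI)
    fix x assume "x \<in> \<Delta>"
    then obtain y where x: "x \<in> carrier_vec N"
      and y: "\<And>t c. t \<in> \<L> \<Longrightarrow> c \<in> P t \<Longrightarrow> x $ c = signed_value y t"
      by (auto simp: polydiagonal_iff)
    \<comment> \<open>\<open>z k\<close> holds the coordinates of the image of the
      \<open>k\<close>-th unit vector; by linearity the image of \<open>x\<close> has the
      coordinates obtained by weighting them with \<open>y k\<close>.\<close>
    have "(laplacian G *\<^sub>v x) $ c = signed_value (\<lambda>i. \<Sum>k=1..p. y k * z k i) t"
      if "t \<in> \<L>" "c \<in> P t" for t c
    proof -
      have "(laplacian G *\<^sub>v x) $ c = (\<Sum>k=1..p. y k * signed_value (z k) t)"
        using laplacian_index[OF x y that] z that by simp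
      also have "\<dots> = signed_value (\<lambda>i. \<Sum>k=1..p. y k * z k i) t"
        by (cases t) (simp_all add: sum_negf)
      finally show ?thesis .
    qed
    moreover have "laplacian G *\<^sub>v x \<in> carrier_vec N"
      by (rule carrier_vecI) (simp add: laplacian_def adjacency_def)
    ultimately show "laplacian G *\<^sub>v x \<in> \<Delta>"
      by (auto simp: polydiagonal_iff)
  qed
qed

section \<open>Invariance as conditions on pairs of parts\<close>

lemma valency_split:
  "valency G c = (\<Sum>j=1..p. input_from G (P (Part j)) c) + (\<Sum>j=1..q. input_from G (P (Counter j)) c)
    + (if r = 1 then input_from G (P Zero_part) c else 0)"
  unfolding valency_def cells_def sum_parts sum_labels input_from_def ..

text \<open>Here \<kappa> is the valency \<open>r_i\<close> of the conditions if
  \<open>k = i\<close>, and \<open>q_ik\<close> otherwise. The negation on the counterpart makes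
  both vectors share one valency; for \<open>i > q\<close> only the part itself is
  constrained.\<close>

definition antisym_const :: "nat \<Rightarrow> nat \<Rightarrow> bool" where
  "antisym_const i k \<longleftrightarrow> (\<exists>\<kappa>. (\<forall>c\<in>P (Part i). coeff (Part i) k c = \<kappa>) \<and>
     (i \<le> q \<longrightarrow> (\<forall>c\<in>P (Counter i). - coeff (Counter i) k c = \<kappa>)))"

text \<open>The coordinates \<open>z i\<close> of an image are independent of each other, so the
  existence of \<open>z\<close> splits into the existence of one constant for each \<open>i\<close>;
  conversely these constants are collected by choice.\<close>

lemma invariant_iff_antisym_const:
  "leaves_invariant (laplacian G) \<Delta> \<longleftrightarrow>
    (\<forall>i\<in>{1..p}. \<forall>k\<in>{1..p}. antisym_const i k) \<and>
    (r = 1 \<longrightarrow> (\<forall>k\<in>{1..p}. \<forall>c\<in>P Zero_part. coeff Zero_part k c = 0))"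
proof -
  have "(\<exists>z. \<forall>t\<in>\<L>. \<forall>c\<in>P t. coeff t k c = signed_value z t) \<longleftrightarrow>
      (\<forall>i\<in>{1..p}. antisym_const i k) \<and> (r = 1 \<longrightarrow> (\<forall>c\<in>P Zero_part. coeff Zero_part k c = 0))"
    (is "?L \<longleftrightarrow> ?R") for k
  proof
    assume ?L
    then obtain z where z: "\<And>t c. t \<in> \<L> \<Longrightarrow> c \<in> P t \<Longrightarrow> coeff t k c = signed_value z t" by blast
    have "antisym_const i k" if "i \<in> {1..p}" for i
      unfolding antisym_const_def
      by (rule exI[of _ "z i"]) (use z[of "Part i"] z[of "Counter i"] that in \<open>auto simp: set_labels\<close>)
    then show ?R using z[of Zero_part] by (auto simp: set_labels)
  next
    assume R: ?R
    then obtain z where "\<And>i c. i \<in> {1..p} \<Longrightarrow> c \<in> P (Part i) \<Longrightarrow> coeff (Part i) k c = z i"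
      "\<And>i c. i \<in> {1..p} \<Longrightarrow> i \<le> q \<Longrightarrow> c \<in> P (Counter i) \<Longrightarrow> - coeff (Counter i) k c = z i"
      unfolding antisym_const_def by metis
    then show ?L
      using R q_le_p
      by (intro exI[of _ z]) (fastforce simp: set_labels neg_equal_iff_equal minus_equation_iff split: if_splits)
  qed
  then show ?thesis
    unfolding invariant_iff by blast
qed

section \<open>The vectors of the conditions as coefficients\<close>

lemma rs_block_labels:
  assumes "s \<in> \<L>" "t \<in> \<L>"
  shows "rs (block G \<sigma> (P s) (P t)) = part_vec \<sigma> (P s) (input_from G (P t))"
  using assms by (intro rs_block part_subset)

lemma regular_part_vec_label:
  assumes "t \<in> \<L>"
  shows "regular_vec (part_vec \<sigma> (P t) f) v \<longleftrightarrow> (\<forall>c\<in>P t. f c = v)"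
  using assms by (intro regular_part_vec part_subset)

lemma vsum_rs_blocks:
  assumes "s \<in> \<L>" "t ` J \<subseteq> \<L>" "finite J"
  shows "vsum (card (P s)) J (\<lambda>j. rs (block G \<sigma> (P s) (P (t j))))
    = part_vec \<sigma> (P s) (\<lambda>c. \<Sum>j\<in>J. input_from G (P (t j)) c)"
proof -
  have "vsum (card (P s)) J (\<lambda>j. rs (block G \<sigma> (P s) (P (t j))))
      = vsum (card (P s)) J (\<lambda>j. part_vec \<sigma> (P s) (input_from G (P (t j))))"
    \<comment> \<open>Congruence comes from the underlying monoid and requires the summands to be
      vectors of length \<open>card (P s)\<close>.\<close>
    unfolding finsum_vec_def
    by (rule comm_monoid.finprod_cong'[OF comm_monoid_vec])
       (use assms rs_block_labels in \<open>auto simp: monoid_vec_simps\<close>)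
  then show ?thesis using part_vec_sum[OF assms(3)] by simp
qed

lemma zero_term:
  assumes "s \<in> \<L>"
  shows "(if r = 1 then rs (block G \<sigma> (P s) (P Zero_part)) else 0\<^sub>v (card (P s)))
    = part_vec \<sigma> (P s) (\<lambda>c. if r = 1 then input_from G (P Zero_part) c else 0)"
  using assms rs_block_labels[of s Zero_part] by (auto simp: set_labels part_vec_zero)

text \<open>In the expanded valency the input from \<open>P (Part i)\<close> is cancelled by
  \<open>input_diff\<close>, while that from the counterpart is counted a second time. This explains
  both the omitted index \<open>j = i\<close> and the factor 2.\<close>

lemma own_coeff_Part:
  assumes "i \<in> {1..q}"
  shows "vsum (card (P (Part i))) ({1..p} - {i}) (\<lambda>j. rs (block G \<sigma> (P (Part i)) (P (Part j))))
      + vsum (card (P (Part i))) ({1..q} - {i}) (\<lambda>j. rs (block G \<sigma> (P (Part i)) (P (Counter j))))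
      + 2 \<cdot>\<^sub>v rs (block G \<sigma> (P (Part i)) (P (Counter i)))
      + (if r = 1 then rs (block G \<sigma> (P (Part i)) (P Zero_part)) else 0\<^sub>v (card (P (Part i))))
    = part_vec \<sigma> (P (Part i)) (coeff (Part i) i)"
proof -
  have L: "Part i \<in> \<L>" "Counter i \<in> \<L>" "Part ` ({1..p} - {i}) \<subseteq> \<L>" "Counter ` ({1..q} - {i}) \<subseteq> \<L>"
    using assms q_le_p by (auto simp: set_labels)
  have i: "i \<in> {1..p}" "i \<in> {1..q}" using assms q_le_p by auto
  show ?thesis
    unfolding vsum_rs_blocks[OF L(1,3)  finite_Diff[OF finite_atLeastAtMost]]
      vsum_rs_blocks[OF L(1,4) finite_Diff[OF finite_atLeastAtMost]]
      zero_term[OF L(1)] rs_block_labels[OF L(1,2)] part_vec_smult part_vec_add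
    using i by (intro arg_cong[of _ _ "part_vec _ _"] ext)
      (simp add: coeff_def input_diff_def valency_split sum_diff1)
qed

text \<open>After the negation the valency enters positively again and the roles are exchanged: the
  input from \<open>P (Counter i)\<close> cancels and that from \<open>P (Part i)\<close>
  doubles.\<close>

lemma own_coeff_Counter:
  assumes "i \<in> {1..q}"
  shows "vsum (card (P (Counter i))) ({1..q} - {i}) (\<lambda>j. rs (block G \<sigma> (P (Counter i)) (P (Counter j))))
      + vsum (card (P (Counter i))) ({1..p} - {i}) (\<lambda>j. rs (block G \<sigma> (P (Counter i)) (P (Part j))))
      + 2 \<cdot>\<^sub>v rs (block G \<sigma> (P (Counter i)) (P (Part i)))
      + (if r = 1 then rs (block G \<sigma> (P (Counter i)) (P Zero_part)) else 0\<^sub>v (card (P (Counter i))))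
    = part_vec \<sigma> (P (Counter i)) (\<lambda>c. - coeff (Counter i) i c)"
proof -
  have L: "Counter i \<in> \<L>" "Part i \<in> \<L>" "Part ` ({1..p} - {i}) \<subseteq> \<L>" "Counter ` ({1..q} - {i}) \<subseteq> \<L>"
    using assms q_le_p by (auto simp: set_labels)
  have i: "i \<in> {1..p}" "i \<in> {1..q}" using assms q_le_p by auto
  show ?thesis
    unfolding vsum_rs_blocks[OF L(1,3) finite_Diff[OF finite_atLeastAtMost]]
      vsum_rs_blocks[OF L(1,4) finite_Diff[OF finite_atLeastAtMost]]
      zero_term[OF L(1)] rs_block_labels[OF L(1,2)] part_vec_smult part_vec_add
    using i by (intro arg_cong[of _ _ "part_vec _ _"] ext)
      (simp add: coeff_def input_diff_def valency_split sum_diff1)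
qed

text \<open>Without a counterpart nothing doubles: only the input from the part itself cancels, and
  the sum over counterparts is complete.\<close>

lemma own_coeff_unpaired:
  assumes "i \<in> {q+1..p}"
  shows "vsum (card (P (Part i))) ({1..p} - {i}) (\<lambda>j. rs (block G \<sigma> (P (Part i)) (P (Part j))))
      + vsum (card (P (Part i))) {1..q} (\<lambda>j. rs (block G \<sigma> (P (Part i)) (P (Counter j))))
      + (if r = 1 then rs (block G \<sigma> (P (Part i)) (P Zero_part)) else 0\<^sub>v (card (P (Part i))))
    = part_vec \<sigma> (P (Part i)) (coeff (Part i) i)"
proof -
  have L: "Part i \<in> \<L>" "Part ` ({1..p} - {i}) \<subseteq> \<L>" "Counter ` {1..q} \<subseteq> \<L>"
    using assms by (auto simp: set_labels)
  have i: "i \<in> {1..p}" "\<not> i \<le> q" using assms by auto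
  show ?thesis
    unfolding vsum_rs_blocks[OF L(1,2) finite_Diff[OF finite_atLeastAtMost]]
      vsum_rs_blocks[OF L(1,3) finite_atLeastAtMost]
      zero_term[OF L(1)] part_vec_add
    using i by (intro arg_cong[of _ _ "part_vec _ _"] ext)
      (simp add: coeff_def input_diff_def valency_split sum_diff1)
qed

text \<open>For \<open>j \<noteq> i\<close> the \<open>j\<close>-th unit vector vanishes on the
  part, so the valency drops out and only the negated \<open>input_diff\<close> remains. The next
  three lemmas rest on the same observation.\<close>

lemma cross_coeff_Part:
  assumes "i \<in> {1..p}" "j \<in> {1..q}" "j \<noteq> i"
  shows "- rs (block G \<sigma> (P (Part i)) (P (Part j))) + rs (block G \<sigma> (P (Part i)) (P (Counter j)))
    = part_vec \<sigma> (P (Part i)) (coeff (Part i) j)"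
  using assms q_le_p
  by (auto simp: rs_block_labels set_labels part_vec_uminus part_vec_add coeff_def input_diff_def
      intro!: arg_cong[of _ _ "part_vec _ _"])

lemma cross_coeff_Counter:
  assumes "i \<in> {1..q}" "j \<in> {1..q}" "j \<noteq> i"
  shows "rs (block G \<sigma> (P (Counter i)) (P (Part j))) - rs (block G \<sigma> (P (Counter i)) (P (Counter j)))
    = part_vec \<sigma> (P (Counter i)) (\<lambda>c. - coeff (Counter i) j c)"
  using assms q_le_p
  by (auto simp: rs_block_labels set_labels part_vec_diff coeff_def input_diff_def
      intro!: arg_cong[of _ _ "part_vec _ _"])

lemma cross_coeff_Part_unpaired:
  assumes "i \<in> {1..p}" "j \<in> {q+1..p}" "j \<noteq> i"
  shows "- rs (block G \<sigma> (P (Part i)) (P (Part j))) = part_vec \<sigma> (P (Part i)) (coeff (Part i) j)"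
  using assms
  by (auto simp: rs_block_labels set_labels part_vec_uminus coeff_def input_diff_def
      intro!: arg_cong[of _ _ "part_vec _ _"])

lemma cross_coeff_Counter_unpaired:
  assumes "i \<in> {1..q}" "j \<in> {q+1..p}"
  shows "rs (block G \<sigma> (P (Counter i)) (P (Part j)))
    = part_vec \<sigma> (P (Counter i)) (\<lambda>c. - coeff (Counter i) j c)"
  using assms
  by (auto simp: rs_block_labels set_labels coeff_def input_diff_def
      intro!: arg_cong[of _ _ "part_vec _ _"])

lemma antisym_const_paired:
  assumes "i \<in> {1..q}"
  shows "antisym_const i k \<longleftrightarrow> (\<exists>\<kappa>. regular_vec (part_vec \<sigma> (P (Part i)) (coeff (Part i) k)) \<kappa> \<and>
    regular_vec (part_vec \<sigma> (P (Counter i)) (\<lambda>c. - coeff (Counter i) k c)) \<kappa>)"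
proof -
  have "Part i \<in> \<L>" "Counter i \<in> \<L>" "i \<le> q"
    using assms q_le_p by (auto simp: set_labels)
  then show ?thesis
    by (simp add: antisym_const_def regular_part_vec_label)
qed

lemma antisym_const_unpaired:
  assumes "i \<in> {q+1..p}"
  shows "antisym_const i k \<longleftrightarrow> (\<exists>\<kappa>. regular_vec (part_vec \<sigma> (P (Part i)) (coeff (Part i) k)) \<kappa>)"
proof -
  have "Part i \<in> \<L>" "\<not> i \<le> q"
    using assms by (auto simp: set_labels)
  then show ?thesis
    by (simp add: antisym_const_def regular_part_vec_label)
qed

text \<open>On the zero part the valency is multiplied by 0, so the coefficient vanishes iff the
  inputs from a part and from its counterpart agree.\<close>

lemma zero_coeff_paired:
  assumes "r = 1" "j \<in> {1..q}"
  shows "rs (block G \<sigma> (P Zero_part) (P (Part j))) = rs (block G \<sigma> (P Zero_part) (P (Counter j)))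
    \<longleftrightarrow> (\<forall>c\<in>P Zero_part. coeff Zero_part j c = 0)"
proof -
  have L: "Zero_part \<in> \<L>" "Part j \<in> \<L>" "Counter j \<in> \<L>"
    using assms q_le_p by (auto simp: set_labels)
  then show ?thesis
    using assms
    by (auto simp: rs_block_labels part_vec_eq_iff[OF part_subset] coeff_def input_diff_def)
qed

lemma zero_coeff_unpaired:
  assumes "r = 1" "j \<in> {q+1..p}"
  shows "regular_mat (block G \<sigma> (P Zero_part) (P (Part j))) 0
    \<longleftrightarrow> (\<forall>c\<in>P Zero_part. coeff Zero_part j c = 0)"
proof -
  have L: "Zero_part \<in> \<L>" "Part j \<in> \<L>"
    using assms by (auto simp: set_labels)
  then show ?thesis
    using assms
    by (auto simp: regular_mat_iff rs_block_labels regular_part_vec_label coeff_def input_diff_def)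
qed

lemma split_range: "(\<forall>i\<in>{1..p}. F i) \<longleftrightarrow> (\<forall>i\<in>{1..q}. F i) \<and> (\<forall>i\<in>{q+1..p}. F i)"
  using q_le_p by (force simp: not_le)

end

section \<open>Matching the coefficients with conditions (i)-(vi)\<close>

theorem corollary4p6:
  fixes G :: weighted_network and n p q r :: nat
    and P :: "part_label \<Rightarrow> nat set" and \<sigma> :: "nat \<Rightarrow> nat"
  assumes "weighted_network G" and "n = num_cells G"
    and "tagged_partition n p q r P"
    and "adapted_enumeration n p q r P \<sigma>"
  shows "leaves_invariant (laplacian G) (polydiagonal n p q r P) \<longleftrightarrow>
    (let
       Q = (\<lambda>i j. block G \<sigma> (P (Part i)) (P (Part j)));
       R = (\<lambda>i j. block G \<sigma> (P (Part i)) (P (Counter j)));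
       Z = (\<lambda>i. block G \<sigma> (P (Part i)) (P Zero_part));
       R' = (\<lambda>i j. block G \<sigma> (P (Counter i)) (P (Part j)));
       Q' = (\<lambda>i j. block G \<sigma> (P (Counter i)) (P (Counter j)));
       Z' = (\<lambda>i. block G \<sigma> (P (Counter i)) (P Zero_part));
       Z0 = (\<lambda>j. block G \<sigma> (P Zero_part) (P (Part j)));
       Z0' = (\<lambda>j. block G \<sigma> (P Zero_part) (P (Counter j)));
       m = (\<lambda>i. card (P (Part i)));
       m' = (\<lambda>i. card (P (Counter i)));
       zterm = (\<lambda>i. if r = 1 then rs (Z i) else 0\<^sub>v (m i));
       zterm' = (\<lambda>i. if r = 1 then rs (Z' i) else 0\<^sub>v (m' i))
     in
       (q > 0 \<longrightarrow>
          \<comment> \<open>(i)\<close>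
          (\<forall>i\<in>{1..q}. \<exists>\<rho>.
             regular_vec (vsum (m i) ({1..p} - {i}) (\<lambda>j. rs (Q i j))
               + vsum (m i) ({1..q} - {i}) (\<lambda>j. rs (R i j))
               + 2 \<cdot>\<^sub>v rs (R i i) + zterm i) \<rho> \<and>
             regular_vec (vsum (m' i) ({1..q} - {i}) (\<lambda>j. rs (Q' i j))
               + vsum (m' i) ({1..p} - {i}) (\<lambda>j. rs (R' i j))
               + 2 \<cdot>\<^sub>v rs (R' i i) + zterm' i) \<rho>) \<and>
          (\<forall>i\<in>{1..q}. \<forall>j\<in>{1..q}. j \<noteq> i \<longrightarrow> (\<exists>\<kappa>.
             regular_vec (- rs (Q i j) + rs (R i j)) \<kappa> \<and>
             regular_vec (rs (R' i j) - rs (Q' i j)) \<kappa>)) \<and>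
          \<comment> \<open>(ii)\<close>
          (\<forall>i\<in>{1..q}. \<forall>j\<in>{q+1..p}. \<exists>\<kappa>.
             regular_vec (- rs (Q i j)) \<kappa> \<and> regular_vec (rs (R' i j)) \<kappa>)) \<and>
       \<comment> \<open>(iii)\<close>
       (\<forall>i\<in>{q+1..p}. \<exists>\<rho>.
          regular_vec (vsum (m i) ({1..p} - {i}) (\<lambda>j. rs (Q i j))
            + vsum (m i) {1..q} (\<lambda>j. rs (R i j)) + zterm i) \<rho>) \<and>
       (\<forall>i\<in>{q+1..p}. \<forall>j\<in>{1..q}. \<exists>\<kappa>. regular_vec (- rs (Q i j) + rs (R i j)) \<kappa>) \<and>
       \<comment> \<open>(iv)\<close>
       (\<forall>i\<in>{q+1..p}. \<forall>j\<in>{q+1..p}. j \<noteq> i \<longrightarrow> (\<exists>\<kappa>. regular_mat (- Q i j) \<kappa>)) \<and>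
       \<comment> \<open>(v)\<close>
       (r = 1 \<longrightarrow> q > 0 \<longrightarrow> (\<forall>j\<in>{1..q}. rs (Z0 j) = rs (Z0' j))) \<and>
       \<comment> \<open>(vi)\<close>
       (r = 1 \<longrightarrow> (\<forall>j\<in>{q+1..p}. regular_mat (Z0 j) 0)))"
proof -
  interpret tagged_network G \<sigma> p q r P
    using assms by unfold_locales (auto simp: adapted_enumeration_def)
  have i: "i \<in> {1..q} \<Longrightarrow> i \<in> {1..p}" "i \<in> {q+1..p} \<Longrightarrow> i \<in> {1..p}"
    and ne: "i \<in> {1..q} \<Longrightarrow> j \<in> {q+1..p} \<Longrightarrow> j \<noteq> i" for i j
    using q_le_p by auto
  \<comment> \<open>The facts 1 to 6 are spelled out so as to match the conditions once the
    \<open>let\<close> is expanded: 1 and 2 serve (i), 3 serves (ii), 4 and 5 serve (iii), 6 serves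
    (iv).\<close>
  have 1: "(\<exists>\<rho>. regular_vec (vsum (card (P (Part i))) ({1..p} - {i}) (\<lambda>j. rs (block G \<sigma> (P (Part i)) (P (Part j))))
      + vsum (card (P (Part i))) ({1..q} - {i}) (\<lambda>j. rs (block G \<sigma> (P (Part i)) (P (Counter j))))
      + 2 \<cdot>\<^sub>v rs (block G \<sigma> (P (Part i)) (P (Counter i)))
      + (if r = 1 then rs (block G \<sigma> (P (Part i)) (P Zero_part)) else 0\<^sub>v (card (P (Part i))))) \<rho> \<and>
      regular_vec (vsum (card (P (Counter i))) ({1..q} - {i}) (\<lambda>j. rs (block G \<sigma> (P (Counter i)) (P (Counter j))))
      + vsum (card (P (Counter i))) ({1..p} - {i}) (\<lambda>j. rs (block G \<sigma> (P (Counter i)) (P (Part j))))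
      + 2 \<cdot>\<^sub>v rs (block G \<sigma> (P (Counter i)) (P (Part i)))
      + (if r = 1 then rs (block G \<sigma> (P (Counter i)) (P Zero_part)) else 0\<^sub>v (card (P (Counter i))))) \<rho>)
    \<longleftrightarrow> antisym_const i i" if "i \<in> {1..q}" for i
    unfolding own_coeff_Part[OF that] own_coeff_Counter[OF that] antisym_const_paired[OF that] ..
  have 2: "(\<exists>\<kappa>. regular_vec (- rs (block G \<sigma> (P (Part i)) (P (Part j))) + rs (block G \<sigma> (P (Part i)) (P (Counter j)))) \<kappa> \<and>
      regular_vec (rs (block G \<sigma> (P (Counter i)) (P (Part j))) - rs (block G \<sigma> (P (Counter i)) (P (Counter j)))) \<kappa>)
    \<longleftrightarrow> antisym_const i j" if "i \<in> {1..q}" "j \<in> {1..q}" "j \<noteq> i" for i j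
    unfolding cross_coeff_Part[OF i(1) that(2,3), OF that(1)] cross_coeff_Counter[OF that]
      antisym_const_paired[OF that(1)] ..
  have 3: "(\<exists>\<kappa>. regular_vec (- rs (block G \<sigma> (P (Part i)) (P (Part j)))) \<kappa> \<and>
      regular_vec (rs (block G \<sigma> (P (Counter i)) (P (Part j)))) \<kappa>)
    \<longleftrightarrow> antisym_const i j" if "i \<in> {1..q}" "j \<in> {q+1..p}" for i j
    unfolding cross_coeff_Part_unpaired[OF i(1) that(2) ne[OF that], OF that(1)]
      cross_coeff_Counter_unpaired[OF that] antisym_const_paired[OF that(1)] ..
  have 4: "(\<exists>\<rho>. regular_vec (vsum (card (P (Part i))) ({1..p} - {i}) (\<lambda>j. rs (block G \<sigma> (P (Part i)) (P (Part j))))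
      + vsum (card (P (Part i))) {1..q} (\<lambda>j. rs (block G \<sigma> (P (Part i)) (P (Counter j))))
      + (if r = 1 then rs (block G \<sigma> (P (Part i)) (P Zero_part)) else 0\<^sub>v (card (P (Part i))))) \<rho>)
    \<longleftrightarrow> antisym_const i i" if "i \<in> {q+1..p}" for i
    unfolding own_coeff_unpaired[OF that] antisym_const_unpaired[OF that] ..
  have 5: "(\<exists>\<kappa>. regular_vec (- rs (block G \<sigma> (P (Part i)) (P (Part j))) + rs (block G \<sigma> (P (Part i)) (P (Counter j)))) \<kappa>)
    \<longleftrightarrow> antisym_const i j" if "i \<in> {q+1..p}" "j \<in> {1..q}" for i j
    unfolding cross_coeff_Part[OF i(2) that(2) ne[OF that(2,1), symmetric], OF that(1)]
      antisym_const_unpaired[OF that(1)] ..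
  have 6: "(\<exists>\<kappa>. regular_mat (- block G \<sigma> (P (Part i)) (P (Part j))) \<kappa>)
    \<longleftrightarrow> antisym_const i j" if "i \<in> {q+1..p}" "j \<in> {q+1..p}" "j \<noteq> i" for i j
    unfolding regular_mat_iff rs_uminus cross_coeff_Part_unpaired[OF i(2) that(2,3), OF that(1)]
      antisym_const_unpaired[OF that(1)] ..
  show ?thesis
    unfolding \<open>n = num_cells G\<close> invariant_iff_antisym_const split_range Let_def
    \<comment> \<open>The congruence rules supply the index ranges, \<open>j \<noteq> i\<close> and
      \<open>r = 1\<close>, under which the equivalences hold. What remains is a regrouping whose
      only premise is that an element of \<open>{1..q}\<close> forces \<open>q > 0\<close>.\<close>
    by (simp only: 1 2 3 4 5 6 zero_coeff_paired zero_coeff_unpaired not_False_eq_True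
          cong: ball_cong imp_cong)
       (rule regroup_conditions, simp)
qed

end
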